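(* Let $\Bbbk$ be a field and let $\mathbb{X}$ be the $\Bbbk$-algebra generated by $y_1,y_2,x_1,x_2$ subject to the relations $$x_2x_1=x_1x_2,\quad y_2y_1=-y_1y_2,\quad y_1x_1=x_1y_2,\quad y_2x_1=x_1y_1,$$ $$y_1x_2=x_1y_2+x_2y_2,\quad y_2x_2=x_1y_1+x_2y_1.$$ Let $S\subset\Bbbk\{y_1,y_2,x_1,x_2\}$ be the set consisting of the six polynomials $$x_2x_1-x_1x_2,\quad y_2y_1+y_1y_2,\quad x_1y_2-y_1x_1,\quad x_1y_1-y_2x_1,$$ $$x_2y_2+y_1x_1-y_1x_2,\quad x_2y_1+y_2x_1-y_2x_2.$$ Then, with respect to the degree lexicographic order with $y_1\prec y_2\prec x_1\prec x_2$, the set $S$ is a Gröbner-Shirshov basis of the ideal $\mathrm{Id}(S)$, which is the ideal of defining relations of $\mathbb{X}$, i.e. $\mathbb{X}=\Bbbk\{y_1,y_2,x_1,x_2\}/\mathrm{Id}(S)$.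
   Context: Let $X=\{y_1,y_2,x_1,x_2\}$ (the alphabet, not to be confused with the algebra $\mathbb{X}$), let $X^*$ be the free monoid of words in $X$, and let $\Bbbk\{X\}$ be the free associative unital $\Bbbk$-algebra on $X$ (noncommutative polynomials). $\mathrm{Id}(S)$ denotes the two-sided ideal of $\Bbbk\{X\}$ generated by $S$. The degree lexicographic order $\prec$ on $X^*$ compares words first by length and then, for equal length, lexicographically from left to right with $y_1\prec y_2\prec x_1\prec x_2$. For a nonzero $f\in\Bbbk\{X\}$, $\overline{f}$ denotes its leading (i.e. $\prec$-largest) word; $f$ is monic if the coefficient of $\overline{f}$ is $1$. For monic $f,g$: (i) if $w=\overline{f}a=b\overline{g}$ with $a,b\in X^*$ and $|\overline{f}|+|\overline{g}|>|w|$, then $(f,g)_w:=fa-bg$ is the intersection composition; (ii) if $w=\overline{f}=a\overline{g}b$ with $a,b\in X^*$, then $(f,g)_w:=f-agb$ is the inclusion composition. A composition $(f,g)_w$ is trivial modulo $S$ if $(f,g)_w=\sum_i\alpha_i a_is_ib_i$ (finite sum) with $\alpha_i\in\Bbbk$, $a_i,b_i\in X^*$, $s_i\in S$ and $a_i\overline{s_i}b_i\prec w$ for all $i$. A nonempty set $S$ of monic polynomials is a Gröbner-Shirshov basis of $\mathrm{Id}(S)$ if every composition $(f,g)_w$ with $f,g\in S$ is trivial modulo $S$. *)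

theory Defs
  imports "HOL-Library.Poly_Mapping" "HOL-Algebra.QuotRing" "HOL-Algebra.Module"
begin

section \<open>The free associative algebra\<close>

text \<open>Lists over an alphabet, with concatenation written additively, form the free monoid of words.
  With this instance the convolution product of \<^theory>\<open>HOL-Library.Poly_Mapping\<close> makes
  \<open>'x list \<Rightarrow>\<^sub>0 'k\<close> the ring of noncommutative polynomials over \<open>'k\<close>.\<close>

instantiation list :: (type) monoid_add
begin

definition zero_list :: "'a list" where "zero_list = []"

definition plus_list :: "'a list \<Rightarrow> 'a list \<Rightarrow> 'a list" where "plus_list u v = u @ v"

instance
  by standard (simp_all add: zero_list_def plus_list_def)

end

type_synonym ('x, 'k) ncpoly = "'x list \<Rightarrow>\<^sub>0 'k"

definition mon :: "'x list \<Rightarrow> ('x, 'k::field) ncpoly" where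
  "mon w = Poly_Mapping.single w 1"

definition scale :: "'k::field \<Rightarrow> ('x, 'k) ncpoly \<Rightarrow> ('x, 'k) ncpoly" where
  "scale c f = Poly_Mapping.single [] c * f"

lemma mon_Nil: "mon [] = 1"
  by (simp add: mon_def flip: zero_list_def)

lemma mon_mult: "mon u * mon v = mon (u @ v)"
  by (simp add: mon_def mult_single flip: plus_list_def)

lemma lookup_scale: "Poly_Mapping.lookup (scale c f) w = c * Poly_Mapping.lookup f w"
proof -
  have "scale c f = Poly_Mapping.map ((*) c) f"
    unfolding scale_def
    by (simp add: mult_map_scale_conv_mult[symmetric] zero_list_def[symmetric])
  then show ?thesis by (simp add: map.rep_eq when_def)
qed

text \<open>The record type of \<^theory>\<open>HOL-Algebra.Module\<close> carries a ring structure together with a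
  scalar multiplication, which is exactly the signature of an algebra over a field.\<close>

definition free_algebra :: "('k::field, ('x, 'k) ncpoly) module" where
  "free_algebra =
     \<lparr>carrier = UNIV, monoid.mult = (*), one = 1, ring.zero = 0, add = (+), smult = scale\<rparr>"

lemma ring_free_algebra: "ring free_algebra"
proof -
  have "\<exists>y. y + x = 0 \<and> x + y = 0" for x :: "('x, 'k::field) ncpoly"
    by (rule exI[of _ "- x"]) simp
  then show ?thesis
    by unfold_locales (auto simp: free_algebra_def algebra_simps Units_def)
qed

section \<open>Presented algebras\<close>

definition ideal_gen :: "('x, 'k::field) ncpoly set \<Rightarrow> ('x, 'k) ncpoly set" where
  "ideal_gen S = genideal free_algebra S"

text \<open>The quotient of an algebra by a two-sided ideal: the quotient ring, with the scalar
  multiplication induced on cosets.\<close>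

definition quotient_algebra :: "('k, 'a) module \<Rightarrow> 'a set \<Rightarrow> ('k, 'a set) module" where
  "quotient_algebra A I = ring.extend (A Quot I)
     (module.fields (\<lambda>c C. \<Union>x\<in>C. I +>\<^bsub>A\<^esub> (c \<odot>\<^bsub>A\<^esub> x)))"

lemma quotient_algebra_smult:
  assumes "ideal I free_algebra"
  shows "c \<odot>\<^bsub>quotient_algebra free_algebra I\<^esub> (I +>\<^bsub>free_algebra\<^esub> x)
           = I +>\<^bsub>free_algebra\<^esub> (c \<odot>\<^bsub>free_algebra\<^esub> x)"
proof -
  interpret ideal I free_algebra by (fact assms)
  have "I +>\<^bsub>free_algebra\<^esub> (scale c (i + x)) = I +>\<^bsub>free_algebra\<^esub> (scale c x)" if "i \<in> I" for i
  proof -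
    have "scale c i \<in> I"
      using I_l_closed[OF that, of "Poly_Mapping.single [] c"] by (simp add: free_algebra_def scale_def)
    moreover have "scale c (i + x) = scale c i + scale c x"
      by (simp add: scale_def algebra_simps)
    ultimately have "scale c (i + x) \<in> I +>\<^bsub>free_algebra\<^esub> (scale c x)"
      by (auto simp: a_r_coset_def' free_algebra_def)
    then show ?thesis
      using a_repr_independence'[of "scale c (i + x)" "scale c x"]
      by (simp add: free_algebra_def)
  qed
  moreover have "I +>\<^bsub>free_algebra\<^esub> x = {i + x | i. i \<in> I}"
    by (auto simp: a_r_coset_def' free_algebra_def)
  moreover have "I \<noteq> {}"
    using additive_subgroup.zero_closed[OF additive_subgroup_axioms] by blast
  ultimately show ?thesis
    by (auto simp: quotient_algebra_def ring.defs module.defs free_algebra_def)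
qed

text \<open>A relation \<open>l = r\<close> is represented by the pair \<open>(l, r)\<close>.\<close>

definition relation_ideal ::
    "(('x, 'k::field) ncpoly \<times> ('x, 'k) ncpoly) set \<Rightarrow> ('x, 'k) ncpoly set" where
  "relation_ideal E = ideal_gen {l - r | l r. (l, r) \<in> E}"

definition presented_algebra ::
    "(('x, 'k::field) ncpoly \<times> ('x, 'k) ncpoly) set \<Rightarrow> ('k, ('x, 'k) ncpoly set) module" where
  "presented_algebra E = quotient_algebra free_algebra (relation_ideal E)"

section \<open>Groebner-Shirshov bases\<close>

text \<open>\<^const>\<open>lenlex\<close> compares lengths first and then, for words of equal length,
  lexicographically from the left.\<close>

definition deglex_less :: "'x::linorder list \<Rightarrow> 'x list \<Rightarrow> bool" (infix \<open>\<prec>\<close> 50) where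
  "u \<prec> v \<longleftrightarrow> (u, v) \<in> lenlex {(a, b). a < b}"

text \<open>Only meaningful for \<open>f \<noteq> 0\<close>.\<close>

definition lead_word :: "('x::linorder, 'k::field) ncpoly \<Rightarrow> 'x list" where
  "lead_word f = (THE w. w \<in> Poly_Mapping.keys f \<and> (\<forall>v \<in> Poly_Mapping.keys f. v \<noteq> w \<longrightarrow> v \<prec> w))"

definition monic :: "('x::linorder, 'k::field) ncpoly \<Rightarrow> bool" where
  "monic f \<longleftrightarrow> f \<noteq> 0 \<and> Poly_Mapping.lookup f (lead_word f) = 1"

text \<open>\<open>composition f g w h\<close> states that \<open>h\<close> is a composition \<open>(f,g)\<^sub>w\<close>. It is a relation because
  \<open>f\<close>, \<open>g\<close> and \<open>w\<close> need not determine the kind of composition or the words \<open>a\<close>, \<open>b\<close>.\<close>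

inductive composition ::
    "('x::linorder, 'k::field) ncpoly \<Rightarrow> ('x, 'k) ncpoly \<Rightarrow> 'x list \<Rightarrow> ('x, 'k) ncpoly \<Rightarrow> bool"
  for f g w where
  intersection: "composition f g w (f * mon a - mon b * g)"
    if "w = lead_word f @ a" "w = b @ lead_word g"
      "length (lead_word f) + length (lead_word g) > length w"
| inclusion: "composition f g w (f - mon a * g * mon b)"
    if "w = lead_word f" "w = a @ lead_word g @ b"

definition trivial_mod ::
    "('x::linorder, 'k::field) ncpoly set \<Rightarrow> 'x list \<Rightarrow> ('x, 'k) ncpoly \<Rightarrow> bool" where
  "trivial_mod S w h \<longleftrightarrow>
     (\<exists>(n::nat) \<alpha> a s b.
        (\<forall>i<n. s i \<in> S \<and> a i @ lead_word (s i) @ b i \<prec> w) \<and>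
        h = (\<Sum>i<n. scale (\<alpha> i) (mon (a i) * s i * mon (b i))))"

definition groebner_shirshov_basis :: "('x::linorder, 'k::field) ncpoly set \<Rightarrow> bool" where
  "groebner_shirshov_basis S \<longleftrightarrow> S \<noteq> {} \<and> (\<forall>f\<in>S. monic f) \<and>
     (\<forall>f\<in>S. \<forall>g\<in>S. \<forall>w h. composition f g w h \<longrightarrow> trivial_mod S w h)"

section \<open>The algebra under consideration\<close>

datatype letter = Y1 | Y2 | X1 | X2

instantiation letter :: linorder
begin

fun letter_rank :: "letter \<Rightarrow> nat" where
  "letter_rank Y1 = 0" | "letter_rank Y2 = 1" | "letter_rank X1 = 2" | "letter_rank X2 = 3"

definition less_eq_letter :: "letter \<Rightarrow> letter \<Rightarrow> bool" where "a \<le> b \<longleftrightarrow> letter_rank a \<le> letter_rank b"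

definition less_letter :: "letter \<Rightarrow> letter \<Rightarrow> bool" where "a < b \<longleftrightarrow> letter_rank a < letter_rank b"

instance
proof
  fix a b :: letter
  show "a \<le> b \<Longrightarrow> b \<le> a \<Longrightarrow> a = b"
    by (cases a; cases b) (simp_all add: less_eq_letter_def)
qed (auto simp: less_eq_letter_def less_letter_def)

end

abbreviation y1 :: "(letter, 'k::field) ncpoly" where "y1 \<equiv> mon [Y1]"
abbreviation y2 :: "(letter, 'k::field) ncpoly" where "y2 \<equiv> mon [Y2]"
abbreviation x1 :: "(letter, 'k::field) ncpoly" where "x1 \<equiv> mon [X1]"
abbreviation x2 :: "(letter, 'k::field) ncpoly" where "x2 \<equiv> mon [X2]"

definition X_relations :: "((letter, 'k::field) ncpoly \<times> (letter, 'k) ncpoly) set" where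
  "X_relations =
     {(x2 * x1, x1 * x2),
      (y2 * y1, - (y1 * y2)),
      (y1 * x1, x1 * y2),
      (y2 * x1, x1 * y1),
      (y1 * x2, x1 * y2 + x2 * y2),
      (y2 * x2, x1 * y1 + x2 * y1)}"

definition X_algebra :: "('k::field, (letter, 'k) ncpoly set) module" where
  "X_algebra = presented_algebra X_relations"

definition X_basis :: "(letter, 'k::field) ncpoly set" where
  "X_basis =
     {x2 * x1 - x1 * x2,
      y2 * y1 + y1 * y2,
      x1 * y2 - y1 * x1,
      x1 * y1 - y2 * x1,
      x2 * y2 + y1 * x1 - y1 * x2,
      x2 * y1 + y2 * x1 - y2 * x2}"

end

theory Submission
  imports Defs
begin

text \<open>The leading words of the six polynomials are \<open>x\<^sub>2x\<^sub>1\<close>, \<open>y\<^sub>2y\<^sub>1\<close>, \<open>x\<^sub>1y\<^sub>2\<close>, \<open>x\<^sub>1y\<^sub>1\<close>, \<open>x\<^sub>2y\<^sub>2\<close>, \<open>x\<^sub>2y\<^sub>1\<close>: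
  distinct words of length two. A composition is therefore either \<open>s - s = 0\<close> or an
  overlap in a single letter (\<open>composition_of_quadratic\<close>), and inspecting the six words leaves just four
  overlaps, namely \<open>x\<^sub>2x\<^sub>1y\<^sub>2\<close>, \<open>x\<^sub>2x\<^sub>1y\<^sub>1\<close>, \<open>x\<^sub>2y\<^sub>2y\<^sub>1\<close> and \<open>x\<^sub>1y\<^sub>2y\<^sub>1\<close>. Each of the four compositions is
  reduced to \<open>0\<close> by repeatedly replacing a leading word by the lower terms; recording the
  multiples of the basis elements that are subtracted on the way gives the explicit identities below,
  which hold over the integers and hence over every field.

  The basis and the defining relations generate the same ideal because they agree up to sign, except
  that the basis elements coming from the relations for \<open>y\<^sub>1x\<^sub>2\<close> and \<open>y\<^sub>2x\<^sub>2\<close> have the terms \<open>x\<^sub>1y\<^sub>2\<close>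
  and \<open>x\<^sub>1y\<^sub>1\<close> replaced by \<open>y\<^sub>1x\<^sub>1\<close> and \<open>y\<^sub>2x\<^sub>1\<close>, using two of the other relations.\<close>

section \<open>Leading words\<close>

lemma deglex_less_asym: "u \<prec> v \<Longrightarrow> \<not> v \<prec> u" for u v :: "'x::linorder list"
proof -
  have "asym {(a::'x, b). a < b}"
    by (auto intro: asymI)
  then have "asym (lenlex {(a::'x, b). a < b})"
    by (rule asym_lenlex)
  then show "u \<prec> v \<Longrightarrow> \<not> v \<prec> u"
    unfolding deglex_less_def by (blast dest: asymD)
qed

lemma lead_word_eqI:
  assumes "w \<in> Poly_Mapping.keys f" "\<And>v. v \<in> Poly_Mapping.keys f \<Longrightarrow> v \<noteq> w \<Longrightarrow> v \<prec> w"
  shows "lead_word f = w"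
  unfolding lead_word_def using assms by (intro the_equality) (auto, metis deglex_less_asym)

lemma lead_word_mon_plus:
  assumes "\<And>v. v \<in> Poly_Mapping.keys r \<Longrightarrow> v \<prec> w"
  shows "lead_word (mon w + r) = w" and "monic (mon w + r)"
proof -
  have "w \<notin> Poly_Mapping.keys r"
    using assms deglex_less_asym by blast
  then have coeff: "Poly_Mapping.lookup (mon w + r) w = 1"
    by (simp add: mon_def lookup_add in_keys_iff)
  show lead: "lead_word (mon w + r) = w"
  proof (rule lead_word_eqI)
    show "w \<in> Poly_Mapping.keys (mon w + r)"
      using coeff by (simp add: in_keys_iff)
  next
    fix v assume "v \<in> Poly_Mapping.keys (mon w + r)" "v \<noteq> w"
    then have "v \<in> Poly_Mapping.keys r"
      using keys_add[of "mon w" r] by (auto simp: mon_def)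
    then show "v \<prec> w"
      by (rule assms)
  qed
  have "mon w + r \<noteq> 0"
    using coeff by force
  then show "monic (mon w + r)"
    using coeff lead by (simp add: monic_def)
qed

section \<open>Compositions\<close>

text \<open>Two overlapping words of length two overlap in one letter or coincide; the empty overlap is
  excluded by the length condition, and inclusion of words of equal length is equality.\<close>

lemma composition_of_quadratic:
  assumes "composition f g w h"
    and "length (lead_word f) = 2" "length (lead_word g) = 2"
  obtains "lead_word f = lead_word g" "h = f - g"
  | p q r where "lead_word f = [p, q]" "lead_word g = [q, r]" "w = [p, q, r]"
      "h = f * mon [r] - mon [p] * g"
  using assms(1)
proof cases
  case (intersection a b)
  from assms obtain p q where f: "lead_word f = [p, q]"
    by (auto simp: numeral_2_eq_2 length_Suc_conv)
  from assms obtain q' r where g: "lead_word g = [q', r]"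
    by (auto simp: numeral_2_eq_2 length_Suc_conv)
  from intersection f g consider "a = []" "b = []" "q' = p" "r = q"
    | "a = [r]" "b = [p]" "q' = q"
    by (cases a; cases b) (auto simp: Cons_eq_append_conv append_eq_Cons_conv)
  then show ?thesis
    using that intersection f g by cases (auto simp: mon_Nil)
next
  case (inclusion a b)
  then have "length a + 2 + length b = 2"
    using assms by (metis add.assoc length_append)
  then show ?thesis
    using that(1) inclusion by (simp add: mon_Nil)
qed

lemma trivial_mod_0: "trivial_mod S w 0"
  unfolding trivial_mod_def by (rule exI[of _ 0]) simp

lemma trivial_mod_add_scale:
  assumes "trivial_mod S w h" "s \<in> S" "a @ lead_word s @ b \<prec> w"
  shows "trivial_mod S w (h + scale c (mon a * s * mon b))"
proof -
  from assms(1) obtain n :: nat and \<alpha> u t v where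
    "\<forall>i<n. t i \<in> S \<and> u i @ lead_word (t i) @ v i \<prec> w"
    and "h = (\<Sum>i<n. scale (\<alpha> i) (mon (u i) * t i * mon (v i)))"
    unfolding trivial_mod_def by blast
  then show ?thesis
    unfolding trivial_mod_def using assms(2,3)
    by (intro exI[of _ "Suc n"] exI[of _ "\<alpha>(n := c)"] exI[of _ "u(n := a)"]
          exI[of _ "t(n := s)"] exI[of _ "v(n := b)"]) (auto simp: less_Suc_eq)
qed

lemma trivial_mod_add:
  assumes "trivial_mod S w h" "s \<in> S" "a @ lead_word s @ b \<prec> w"
  shows "trivial_mod S w (h + mon a * s * mon b)"
  using trivial_mod_add_scale[OF assms, of 1]
  by (simp add: scale_def flip: zero_list_def)

lemma trivial_mod_diff:
  assumes "trivial_mod S w h" "s \<in> S" "a @ lead_word s @ b \<prec> w"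
  shows "trivial_mod S w (h - mon a * s * mon b)"
  using trivial_mod_add_scale[OF assms, of "- 1"]
  by (simp add: scale_def single_uminus flip: zero_list_def)

section \<open>The six polynomials\<close>

text \<open>As opaque constants named after their leading words, the basis elements are told apart by
  those words alone, and are expanded only where their lower terms matter.\<close>

definition s_x2x1 :: "(letter, 'k::field) ncpoly" where "s_x2x1 = x2 * x1 - x1 * x2"
definition s_y2y1 :: "(letter, 'k::field) ncpoly" where "s_y2y1 = y2 * y1 + y1 * y2"
definition s_x1y2 :: "(letter, 'k::field) ncpoly" where "s_x1y2 = x1 * y2 - y1 * x1"
definition s_x1y1 :: "(letter, 'k::field) ncpoly" where "s_x1y1 = x1 * y1 - y2 * x1"
definition s_x2y2 :: "(letter, 'k::field) ncpoly" where "s_x2y2 = x2 * y2 + y1 * x1 - y1 * x2"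
definition s_x2y1 :: "(letter, 'k::field) ncpoly" where "s_x2y1 = x2 * y1 + y2 * x1 - y2 * x2"

lemmas s_defs = s_x2x1_def s_y2y1_def s_x1y2_def s_x1y1_def s_x2y2_def s_x2y1_def

lemma X_basis_eq: "X_basis = {s_x2x1, s_y2y1, s_x1y2, s_x1y1, s_x2y2, s_x2y1}"
  by (simp add: X_basis_def s_defs)

lemma lead_words [simp]:
  "lead_word s_x2x1 = [X2, X1]" "lead_word s_y2y1 = [Y2, Y1]" "lead_word s_x1y2 = [X1, Y2]"
  "lead_word s_x1y1 = [X1, Y1]" "lead_word s_x2y2 = [X2, Y2]" "lead_word s_x2y1 = [X2, Y1]"
  and monic_s: "monic s_x2x1" "monic s_y2y1" "monic s_x1y2" "monic s_x1y1" "monic s_x2y2" "monic s_x2y1"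
proof -
  have lower_terms:
    "s_x2x1 = mon [X2, X1] + - mon [X1, X2]"
    "s_y2y1 = mon [Y2, Y1] + mon [Y1, Y2]"
    "s_x1y2 = mon [X1, Y2] + - mon [Y1, X1]"
    "s_x1y1 = mon [X1, Y1] + - mon [Y2, X1]"
    "s_x2y2 = mon [X2, Y2] + (mon [Y1, X1] - mon [Y1, X2])"
    "s_x2y1 = mon [X2, Y1] + (mon [Y2, X1] - mon [Y2, X2])"
    by (simp_all add: s_defs mon_mult)
  have keys_le: "v \<in> Poly_Mapping.keys (mon t) \<Longrightarrow> v = t"
    "v \<in> Poly_Mapping.keys (- mon t) \<Longrightarrow> v = t"
    "v \<in> Poly_Mapping.keys (mon t - mon u) \<Longrightarrow> v = t \<or> v = u" for v t u :: "letter list"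
    using keys_diff[of "mon t" "mon u"] by (auto simp: mon_def)
  show "lead_word s_x2x1 = [X2, X1]" "lead_word s_y2y1 = [Y2, Y1]" "lead_word s_x1y2 = [X1, Y2]"
    "lead_word s_x1y1 = [X1, Y1]" "lead_word s_x2y2 = [X2, Y2]" "lead_word s_x2y1 = [X2, Y1]"
    unfolding lower_terms
    by (rule lead_word_mon_plus; auto dest!: keys_le simp: deglex_less_def lenlex_conv less_letter_def)+
  show "monic s_x2x1" "monic s_y2y1" "monic s_x1y2" "monic s_x1y1" "monic s_x2y2" "monic s_x2y1"
    unfolding lower_terms
    by (rule lead_word_mon_plus; auto dest!: keys_le simp: deglex_less_def lenlex_conv less_letter_def)+
qed

section \<open>The four overlaps\<close>

text \<open>The right-hand sides are written from \<open>0\<close> as \<open>mon a * s * mon b\<close> summands, the form in which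
  triviality is accumulated; they come from rewriting the left-hand side to normal form.\<close>

lemma overlap_x2x1y2:
  "s_x2x1 * y2 - x2 * s_x1y2
     = 0 - mon [X1] * s_x2y2 * mon [] + mon [] * s_x1y1 * mon [X1] - mon [] * s_x1y1 * mon [X2]
         + mon [] * s_x2y1 * mon [X1] + mon [Y2] * s_x2x1 * mon []"
  by (simp add: s_defs mon_Nil algebra_simps)

lemma overlap_x2x1y1:
  "s_x2x1 * y1 - x2 * s_x1y1
     = 0 - mon [X1] * s_x2y1 * mon [] + mon [] * s_x1y2 * mon [X1] - mon [] * s_x1y2 * mon [X2]
         + mon [] * s_x2y2 * mon [X1] + mon [Y1] * s_x2x1 * mon []"
  by (simp add: s_defs mon_Nil algebra_simps)

text \<open>The reduction ends in \<open>2 (y\<^sub>1y\<^sub>2 + y\<^sub>2y\<^sub>1) x\<^sub>1 - (y\<^sub>1y\<^sub>2 + y\<^sub>2y\<^sub>1) x\<^sub>2\<close>, hence the repeated summand.\<close>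

lemma overlap_x2y2y1:
  "s_x2y2 * y1 - x2 * s_y2y1
     = 0 - mon [] * s_x2y1 * mon [Y2] + mon [Y1] * s_x1y1 * mon [] - mon [Y1] * s_x2y1 * mon []
         + mon [Y2] * s_x1y2 * mon [] - mon [Y2] * s_x2y2 * mon []
         + mon [] * s_y2y1 * mon [X1] + mon [] * s_y2y1 * mon [X1] - mon [] * s_y2y1 * mon [X2]"
  by (simp add: s_defs mon_Nil algebra_simps)

lemma overlap_x1y2y1:
  "s_x1y2 * y1 - x1 * s_y2y1
     = 0 - mon [Y1] * s_x1y1 * mon [] - mon [] * s_x1y1 * mon [Y2] - mon [Y2] * s_x1y2 * mon []
         - mon [] * s_y2y1 * mon [X1]"
  by (simp add: s_defs mon_Nil algebra_simps)

lemma trivial_overlaps: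
  "trivial_mod X_basis [X2, X1, Y2] (s_x2x1 * y2 - x2 * s_x1y2)"
  "trivial_mod X_basis [X2, X1, Y1] (s_x2x1 * y1 - x2 * s_x1y1)"
  "trivial_mod X_basis [X2, Y2, Y1] (s_x2y2 * y1 - x2 * s_y2y1)"
  "trivial_mod X_basis [X1, Y2, Y1] (s_x1y2 * y1 - x1 * s_y2y1)"
  unfolding overlap_x2x1y2 overlap_x2x1y1 overlap_x2y2y1 overlap_x1y2y1
  by (intro trivial_mod_add trivial_mod_diff trivial_mod_0;
      simp add: X_basis_eq deglex_less_def lenlex_conv less_letter_def)+

lemma groebner_shirshov_X_basis: "groebner_shirshov_basis X_basis"
  unfolding groebner_shirshov_basis_def
proof (intro conjI ballI allI impI)
  show "X_basis \<noteq> {}"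
    by (simp add: X_basis_eq)
next
  fix f assume "f \<in> (X_basis :: (letter, 'a) ncpoly set)"
  then show "monic f"
    by (auto simp: X_basis_eq monic_s)
next
  fix f g h :: "(letter, 'a) ncpoly" and w
  assume f: "f \<in> X_basis" and g: "g \<in> X_basis" and comp: "composition f g w h"
  have quadratic: "length (lead_word s) = 2" if "s \<in> X_basis" for s :: "(letter, 'a) ncpoly"
    using that by (auto simp: X_basis_eq)
  from comp quadratic[OF f] quadratic[OF g] show "trivial_mod X_basis w h"
  proof (cases rule: composition_of_quadratic)
    case 1
    then have "f = g"
      using f g by (auto simp: X_basis_eq)
    then show ?thesis
      using 1 by (simp add: trivial_mod_0)
  next
    case (2 p q r)
    then show ?thesis
      using f g unfolding X_basis_eq
      by (auto simp: trivial_overlaps[unfolded X_basis_eq])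
  qed
qed

section \<open>The ideal of relations\<close>

lemma ideal_ideal_gen: "ideal (ideal_gen S) free_algebra"
  unfolding ideal_gen_def
  by (rule ring.genideal_ideal[OF ring_free_algebra]) (simp add: free_algebra_def)

lemma ideal_gen_incl: "s \<in> S \<Longrightarrow> s \<in> ideal_gen S"
  unfolding ideal_gen_def
  using ring.genideal_self[OF ring_free_algebra, of S] by (auto simp: free_algebra_def)

lemma ideal_gen_subset: "S \<subseteq> ideal_gen T \<Longrightarrow> ideal_gen S \<subseteq> ideal_gen T"
  using ring.genideal_minimal[OF ring_free_algebra ideal_ideal_gen]
  unfolding ideal_gen_def by blast

lemma ideal_gen_add: "f \<in> ideal_gen S \<Longrightarrow> g \<in> ideal_gen S \<Longrightarrow> f + g \<in> ideal_gen S"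
  using additive_subgroup.a_closed[OF ideal.axioms(1)[OF ideal_ideal_gen], of f S g]
  by (simp add: free_algebra_def)

lemma ideal_gen_uminus: "f \<in> ideal_gen S \<Longrightarrow> - f \<in> ideal_gen S"
  using ideal.I_l_closed[OF ideal_ideal_gen, of f S "- 1"] by (simp add: free_algebra_def)

lemma ideal_gen_X_basis: "ideal_gen X_basis = relation_ideal X_relations"
proof -
  define R :: "(letter, 'a) ncpoly set" where
    "R = {s_x2x1, s_y2y1, - s_x1y2, - s_x1y1, - s_x2y2 + - s_x1y2, - s_x2y1 + - s_x1y1}"
  have "{l - r | l r. (l, r) \<in> (X_relations :: ((letter, 'a) ncpoly \<times> _) set)}
      = (\<lambda>(l, r). l - r) ` X_relations"
    by force
  also have "\<dots> = R"
    by (simp add: X_relations_def R_def s_defs algebra_simps)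
  finally have relation_ideal: "relation_ideal X_relations = ideal_gen R"
    by (simp add: relation_ideal_def)
  have "R \<subseteq> ideal_gen X_basis"
    unfolding R_def insert_subset X_basis_eq
    by (intro conjI empty_subsetI ideal_gen_add ideal_gen_uminus ideal_gen_incl; simp)
  moreover have "X_basis \<subseteq> ideal_gen R"
  proof -
    have "s_x2x1 \<in> ideal_gen R" "s_y2y1 \<in> ideal_gen R"
      by (simp_all add: R_def ideal_gen_incl)
    moreover have s1: "s_x1y2 \<in> ideal_gen R" "s_x1y1 \<in> ideal_gen R"
      using ideal_gen_uminus[OF ideal_gen_incl, of "- s_x1y2" R]
        ideal_gen_uminus[OF ideal_gen_incl, of "- s_x1y1" R] by (simp_all add: R_def)
    moreover have "s_x2y2 \<in> ideal_gen R" "s_x2y1 \<in> ideal_gen R"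
    proof -
      have "- s_x2y2 + - s_x1y2 \<in> ideal_gen R" "- s_x2y1 + - s_x1y1 \<in> ideal_gen R"
        by (simp_all only: R_def insert_iff simp_thms ideal_gen_incl)
      from this[THEN ideal_gen_add, OF s1(1)] this[THEN ideal_gen_add, OF s1(2)]
      have "- s_x2y2 \<in> ideal_gen R" "- s_x2y1 \<in> ideal_gen R"
        by (simp_all add: add.assoc)
      from this[THEN ideal_gen_uminus] show "s_x2y2 \<in> ideal_gen R" "s_x2y1 \<in> ideal_gen R"
        by simp_all
    qed
    ultimately show ?thesis
      by (simp add: X_basis_eq)
  qed
  ultimately show ?thesis
    unfolding relation_ideal by (intro equalityI ideal_gen_subset)
qed

theorem mainTheorem11:
  shows "groebner_shirshov_basis (X_basis :: (letter, 'k::field) ncpoly set)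
       \<and> ideal_gen (X_basis :: (letter, 'k) ncpoly set) = relation_ideal X_relations
       \<and> (X_algebra :: ('k, (letter, 'k) ncpoly set) module)
           = quotient_algebra free_algebra (ideal_gen X_basis)"
  by (simp add: groebner_shirshov_X_basis ideal_gen_X_basis X_algebra_def presented_algebra_def)

end
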